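(* Let $\mathbf{W}$ and $\mathbf{W}'$ be unitary systems on a Hilbert space $\mathcal{H}$ of finite dimension $d\ge2$, and let $\{\mathbf{V}_\alpha:\alpha\in\Lambda\}$ and $\{\mathbf{V}'_\beta:\beta\in\Lambda'\}$ be the families of all $\mathbf{W}$-MASS's and all $\mathbf{W}'$-MASS's respectively (indexed without repetition). Let $V$ be a unitary operator on $\mathcal{H}$. Then $\mathbf{W}$ is collectively unitarily equivalent to $\mathbf{W}'$ via $V$ if and only if there is a bijective map $\alpha\mapsto\alpha'$ from $\Lambda$ to $\Lambda'$ such that, for each $\alpha\in\Lambda$, $\mathbf{V}_\alpha$ is collectively unitarily equivalent to $\mathbf{V}'_{\alpha'}$ via $V$.
   Context: A unitary system is a non-empty set $\mathbf{W}=\{W_y:y\in Y\}$ of unitary operators on $\mathcal{H}$ with $\mathrm{tr}\,W_y=0$ and $\mathrm{tr}(W_x^*W_y)=d\,\delta_{xy}$ for $x,y\in Y$. A $\mathbf{W}$-MASS (maximal abelian subsystem) is a subset of $\mathbf{W}$ whose elements commute pairwise and which is maximal with this property. The union of all $\mathbf{W}$-MASS's is $\mathbf{W}$. Subsets $\mathcal{F},\mathcal{G}$ of $\mathcal{B}(\mathcal{H})$ are collectively unitarily equivalent via a unitary $V$ if $\mathcal{G}=\{V^*AV:A\in\mathcal{F}\}$. *)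

theory Defs
  imports Complex_Main
begin

text \<open>
  Complex Hilbert spaces of finite dimension; completeness is automatic in finite dimension.
  The inner product is antilinear in its first argument.
\<close>

class fin_dim_hilbert = ab_group_add +
  fixes scaleC :: "complex \<Rightarrow> 'a \<Rightarrow> 'a" (infixr "*\<^sub>C" 75)
    and cinner :: "'a \<Rightarrow> 'a \<Rightarrow> complex"
  assumes scaleC_add_right: "c *\<^sub>C (x + y) = c *\<^sub>C x + c *\<^sub>C y"
    and scaleC_add_left: "(b + c) *\<^sub>C x = b *\<^sub>C x + c *\<^sub>C x"
    and scaleC_scaleC: "b *\<^sub>C c *\<^sub>C x = (b * c) *\<^sub>C x"
    and scaleC_one: "1 *\<^sub>C x = x"
    and cinner_commute: "cinner x y = cnj (cinner y x)"
    and cinner_add_right: "cinner x (y + z) = cinner x y + cinner x z"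
    and cinner_scaleC_right: "cinner x (c *\<^sub>C y) = c * cinner x y"
    and cinner_pos: "x \<noteq> 0 \<Longrightarrow> 0 < Re (cinner x x)"
    and finite_dim: "\<exists>B. finite B \<and> (\<forall>x. \<exists>c. x = (\<Sum>b\<in>B. c b *\<^sub>C b))"

global_interpretation cvec: vector_space "scaleC :: complex \<Rightarrow> 'a \<Rightarrow> 'a::fin_dim_hilbert"
  by unfold_locales (simp_all add: scaleC_add_right scaleC_add_left scaleC_scaleC scaleC_one)

abbreviation hdim :: "'a::fin_dim_hilbert itself \<Rightarrow> nat"
  where "hdim _ \<equiv> cvec.dim (UNIV :: 'a set)"

abbreviation clinear :: "('a::fin_dim_hilbert \<Rightarrow> 'a) \<Rightarrow> bool"
  where "clinear \<equiv> Vector_Spaces.linear scaleC scaleC"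

definition adj :: "('a::fin_dim_hilbert \<Rightarrow> 'a) \<Rightarrow> 'a \<Rightarrow> 'a"
  where "adj A = (THE B. \<forall>x y. cinner (A x) y = cinner x (B y))"

definition unitary :: "('a::fin_dim_hilbert \<Rightarrow> 'a) \<Rightarrow> bool"
  where "unitary U \<longleftrightarrow> clinear U \<and> adj U \<circ> U = id \<and> U \<circ> adj U = id"

text \<open>
  The trace is the sum of the diagonal entries with respect to some basis
  (\<open>cvec.extend_basis {}\<close> is a basis); see \<open>tr_eq\<close> below for independence of the basis.
\<close>

definition tr :: "('a::fin_dim_hilbert \<Rightarrow> 'a) \<Rightarrow> complex"
  where "tr A = (let B = cvec.extend_basis {} in \<Sum>b\<in>B. cvec.representation B (A b) b)"

definition unitary_system :: "'y set \<Rightarrow> ('y \<Rightarrow> 'a::fin_dim_hilbert \<Rightarrow> 'a) \<Rightarrow> bool"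
  where "unitary_system Y W \<longleftrightarrow> Y \<noteq> {} \<and>
    (\<forall>y\<in>Y. unitary (W y) \<and> tr (W y) = 0) \<and>
    (\<forall>x\<in>Y. \<forall>y\<in>Y. tr (adj (W x) \<circ> W y) = (if x = y then of_nat (hdim TYPE('a)) else 0))"

definition commuting :: "('a \<Rightarrow> 'a) set \<Rightarrow> bool"
  where "commuting M \<longleftrightarrow> (\<forall>A\<in>M. \<forall>B\<in>M. A \<circ> B = B \<circ> A)"

definition MASS :: "('a \<Rightarrow> 'a) set \<Rightarrow> ('a \<Rightarrow> 'a) set \<Rightarrow> bool"
  where "MASS S M \<longleftrightarrow> M \<subseteq> S \<and> commuting M \<and>
    (\<forall>N. N \<subseteq> S \<and> commuting N \<and> M \<subseteq> N \<longrightarrow> N = M)"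

definition coll_unitarily_equiv_via ::
  "('a::fin_dim_hilbert \<Rightarrow> 'a) \<Rightarrow> ('a \<Rightarrow> 'a) set \<Rightarrow> ('a \<Rightarrow> 'a) set \<Rightarrow> bool"
  where "coll_unitarily_equiv_via V F G \<longleftrightarrow> unitary V \<and> G = {adj V \<circ> A \<circ> V | A. A \<in> F}"


subsection \<open>The definitions of adjoint and trace are meaningful\<close>

lemma finite_independent:
  assumes "cvec.independent (B :: 'a::fin_dim_hilbert set)"
  shows "finite B" "card B \<le> hdim TYPE('a)"
proof -
  obtain S :: "'a set" where S: "finite S" "cvec.span S = UNIV"
    using finite_dim[where 'a = 'a] by (force simp: cvec.span_finite)
  show *: "finite B"
    using cvec.independent_span_bound[OF S(1) assms] S(2) by simp
  obtain C where C: "B \<subseteq> C" "cvec.independent C" "cvec.span C = UNIV"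
    using cvec.maximal_independent_subset_extend[of B UNIV] assms by (metis subset_UNIV top.extremum_uniqueI)
  have "finite C" using cvec.independent_span_bound[OF S(1) C(2)] S(2) by simp
  then have "card B \<le> card C" using C(1) by (rule card_mono)
  also have "card C = hdim TYPE('a)" using cvec.dim_eq_card[of C UNIV] C by simp
  finally show "card B \<le> hdim TYPE('a)" .
qed

lemma tr_basis_change:
  fixes A :: "'a::fin_dim_hilbert \<Rightarrow> 'a"
  assumes A: "clinear A"
    and B: "cvec.independent B" "cvec.span B = UNIV"
    and C: "cvec.independent C" "cvec.span C = UNIV"
  shows "(\<Sum>b\<in>B. cvec.representation B (A b) b) = (\<Sum>c\<in>C. cvec.representation C (A c) c)"
proof -
  interpret A: Vector_Spaces.linear scaleC scaleC A by (fact A)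
  note fB = finite_independent(1)[OF B(1)] and fC = finite_independent(1)[OF C(1)]
  have expand: "x = (\<Sum>d\<in>D. cvec.representation D x d *\<^sub>C d)"
    if "cvec.independent D" "cvec.span D = UNIV" for D and x :: 'a
    using cvec.sum_representation_eq[of D x D] that finite_independent(1)[of D] by simp
  have rep: "cvec.representation D (\<Sum>i\<in>I. f i *\<^sub>C g i) d =
      (\<Sum>i\<in>I. f i * cvec.representation D (g i) d)"
    if "cvec.independent D" "cvec.span D = UNIV" for D I f d and g :: "'a \<Rightarrow> 'a"
    using that by (simp add: cvec.representation_sum cvec.representation_scale)
  have "(\<Sum>b\<in>B. cvec.representation B (A b) b) =
      (\<Sum>b\<in>B. \<Sum>c\<in>C. cvec.representation C b c * cvec.representation B (A c) b)"
  proof (rule sum.cong[OF refl])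
    fix b
    have "A b = (\<Sum>c\<in>C. cvec.representation C b c *\<^sub>C A c)"
      by (subst expand[OF C, of b]) (simp add: A.sum A.scale)
    then show "cvec.representation B (A b) b =
        (\<Sum>c\<in>C. cvec.representation C b c * cvec.representation B (A c) b)"
      by (simp add: rep[OF B])
  qed
  also have "\<dots> = (\<Sum>c\<in>C. \<Sum>b\<in>B. cvec.representation B (A c) b * cvec.representation C b c)"
    by (subst sum.swap) (simp add: mult.commute)
  also have "\<dots> = (\<Sum>c\<in>C. cvec.representation C (A c) c)"
  proof (rule sum.cong[OF refl])
    fix c
    show "(\<Sum>b\<in>B. cvec.representation B (A c) b * cvec.representation C b c) =
        cvec.representation C (A c) c"
      using arg_cong[OF expand[OF B, of "A c"], of "\<lambda>x. cvec.representation C x c"]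
      unfolding rep[OF C] by (rule sym)
  qed
  finally show ?thesis .
qed

lemma tr_eq:
  fixes A :: "'a::fin_dim_hilbert \<Rightarrow> 'a"
  assumes "clinear A" "cvec.independent B" "cvec.span B = UNIV"
  shows "tr A = (\<Sum>b\<in>B. cvec.representation B (A b) b)"
  unfolding tr_def Let_def
proof (rule tr_basis_change[OF assms(1) _ _ assms(2,3)])
  show "cvec.independent (cvec.extend_basis {} :: 'a set)"
    by (rule cvec.independent_extend_basis[OF cvec.independent_empty])
  show "cvec.span (cvec.extend_basis {} :: 'a set) = UNIV"
    by (rule cvec.span_extend_basis[OF cvec.independent_empty])
qed

lemma cinner_zero_right [simp]: "cinner x 0 = 0"
  using cinner_add_right[of x 0 0] by simp

lemma cinner_zero_left [simp]: "cinner 0 x = 0"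
  using cinner_commute[of 0 x] by simp

lemma cinner_minus_right: "cinner x (- y) = - cinner x y"
  using cinner_add_right[of x y "- y"] by (simp add: eq_neg_iff_add_eq_0 add.commute)

lemma cinner_diff_right: "cinner x (y - z) = cinner x y - cinner x z"
  using cinner_add_right[of x y "- z"] by (simp add: cinner_minus_right)

lemma cinner_add_left: "cinner (x + y) z = cinner x z + cinner y z"
  by (metis cinner_add_right cinner_commute complex_cnj_add)

lemma cinner_scaleC_left: "cinner (c *\<^sub>C x) y = cnj c * cinner x y"
  by (metis cinner_scaleC_right cinner_commute complex_cnj_mult)

lemma cinner_sum_right: "cinner x (\<Sum>i\<in>I. f i) = (\<Sum>i\<in>I. cinner x (f i))"
  by (induction I rule: infinite_finite_induct) (simp_all add: cinner_add_right)

lemma cinner_sum_left: "cinner (\<Sum>i\<in>I. f i) x = (\<Sum>i\<in>I. cinner (f i) x)"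
  by (induction I rule: infinite_finite_induct) (simp_all add: cinner_add_left)

lemma cinner_eqI:
  assumes "\<And>x. cinner x y = cinner x z"
  shows "y = z"
  using assms[of "y - z"] cinner_pos[of "y - z"] by (force simp: cinner_diff_right)

definition orthonormal :: "'a::fin_dim_hilbert set \<Rightarrow> bool"
  where "orthonormal E \<longleftrightarrow> (\<forall>e\<in>E. \<forall>f\<in>E. cinner e f = (if e = f then 1 else 0))"

lemma orthonormal_independent:
  assumes "orthonormal (E :: 'a::fin_dim_hilbert set)"
  shows "cvec.independent E"
proof
  assume "cvec.dependent E"
  then obtain S u v where S: "finite S" "S \<subseteq> E" "v \<in> S" "u v \<noteq> 0" "(\<Sum>w\<in>S. u w *\<^sub>C w) = 0"
    unfolding cvec.dependent_explicit by blast
  have "0 = cinner v (\<Sum>w\<in>S. u w *\<^sub>C w)" using S(5) by simp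
  also have "\<dots> = (\<Sum>w\<in>S. if w = v then u w else 0)"
    unfolding cinner_sum_right
  proof (rule sum.cong[OF refl])
    fix w assume "w \<in> S"
    then have "v \<in> E" "w \<in> E" using S by auto
    then show "cinner v (u w *\<^sub>C w) = (if w = v then u w else 0)"
      using assms by (simp add: cinner_scaleC_right orthonormal_def)
  qed
  also have "\<dots> = u v" using S by simp
  finally show False using S(4) by simp
qed

lemma orthonormal_basis_exists:
  "\<exists>E. finite E \<and> orthonormal E \<and> (\<forall>x::'a::fin_dim_hilbert. x = (\<Sum>e\<in>E. cinner e x *\<^sub>C e))"
proof -
  let ?P = "\<lambda>E :: 'a set. orthonormal E"
  have "\<exists>E. ?P E \<and> (\<forall>F. ?P F \<longrightarrow> card F \<le> card E)"
  proof (rule ex_has_greatest_nat)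
    show "orthonormal ({} :: 'a set)" by (simp add: orthonormal_def)
    show "\<forall>F :: 'a set. orthonormal F \<longrightarrow> card F < Suc (hdim TYPE('a))"
      using finite_independent(2) orthonormal_independent less_Suc_eq_le by blast
  qed
  then obtain E :: "'a set" where E: "orthonormal E"
    and max: "\<And>F :: 'a set. orthonormal F \<Longrightarrow> card F \<le> card E" by blast
  have fin: "finite E" by (rule finite_independent(1)[OF orthonormal_independent[OF E]])
  have "x = (\<Sum>e\<in>E. cinner e x *\<^sub>C e)" for x
  proof (rule ccontr)
    define y where "y = x - (\<Sum>e\<in>E. cinner e x *\<^sub>C e)"
    define n where "n = complex_of_real (1 / sqrt (Re (cinner y y)))"
    define z where "z = n *\<^sub>C y"
    assume "x \<noteq> (\<Sum>e\<in>E. cinner e x *\<^sub>C e)"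
    then have pos: "0 < Re (cinner y y)" by (intro cinner_pos) (simp add: y_def)
    have real: "cinner y y = of_real (Re (cinner y y))"
      using cinner_commute[of y y] by (simp add: complex_eq_iff)
    have "cinner e y = 0" if "e \<in> E" for e
    proof -
      have "cinner e (\<Sum>f\<in>E. cinner f x *\<^sub>C f) = (\<Sum>f\<in>E. if f = e then cinner f x else 0)"
        unfolding cinner_sum_right
        by (rule sum.cong) (use E that in \<open>auto simp: cinner_scaleC_right orthonormal_def\<close>)
      then show ?thesis using fin that by (simp add: y_def cinner_diff_right)
    qed
    then have ez: "cinner e z = 0" "cinner z e = 0" if "e \<in> E" for e
      using that cinner_commute[of z e] by (simp_all add: z_def cinner_scaleC_right)
    have "cinner z z = of_real (1 / sqrt (Re (cinner y y)) * (1 / sqrt (Re (cinner y y))) * Re (cinner y y))"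
      unfolding z_def cinner_scaleC_left cinner_scaleC_right n_def of_real_mult
      by (subst real) simp
    also have "\<dots> = 1" using pos by simp
    finally have zz: "cinner z z = 1" .
    have "z \<notin> E" using ez zz by fastforce
    moreover have "orthonormal (insert z E)"
      using E ez zz by (auto simp: orthonormal_def)
    ultimately show False using max[of "insert z E"] fin by simp
  qed
  then show ?thesis using E fin by blast
qed

lemma cinner_adj:
  fixes A :: "'a::fin_dim_hilbert \<Rightarrow> 'a"
  assumes "clinear A"
  shows "cinner (A x) y = cinner x (adj A y)"
proof -
  interpret A: Vector_Spaces.linear scaleC scaleC A by (fact assms)
  obtain E :: "'a set" where E: "\<And>x. x = (\<Sum>e\<in>E. cinner e x *\<^sub>C e)"
    using orthonormal_basis_exists by blast
  define B where "B y = (\<Sum>e\<in>E. cinner (A e) y *\<^sub>C e)" for y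
  have B: "cinner (A x) y = cinner x (B y)" for x y
  proof -
    have "A x = (\<Sum>e\<in>E. cinner e x *\<^sub>C A e)"
      by (subst E[of x]) (simp add: A.sum A.scale)
    then have "cinner (A x) y = (\<Sum>e\<in>E. cnj (cinner e x) * cinner (A e) y)"
      by (simp add: cinner_sum_left cinner_scaleC_left)
    also have "\<dots> = (\<Sum>e\<in>E. cinner (A e) y * cinner x e)"
      by (simp add: mult.commute flip: cinner_commute[of x])
    also have "\<dots> = cinner x (B y)"
      by (simp add: B_def cinner_sum_right cinner_scaleC_right)
    finally show ?thesis .
  qed
  have "\<forall>x y. cinner (A x) y = cinner x (adj A y)"
    unfolding adj_def
  proof (rule theI[of _ B])
    show "\<forall>x y. cinner (A x) y = cinner x (B y)" using B by blast
    show "C = B" if C: "\<forall>x y. cinner (A x) y = cinner x (C y)" for C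
    proof
      fix y
      show "C y = B y" by (rule cinner_eqI) (simp only: C[rule_format, symmetric] B[symmetric])
    qed
  qed
  then show ?thesis by blast
qed

end

theory Submission
  imports Defs
begin

text \<open>
  Conjugation \<open>A \<mapsto> V\<^sup>* A V\<close> is injective and preserves and reflects commutation, so it induces a
  bijection between the maximal abelian subsystems of a set and those of its image. Conversely, by
  Zorn's lemma the maximal abelian subsystems of a set cover it, so matching them matches the sets.
\<close>

text \<open>A single operator commutes with itself, so \<open>{A}\<close> is a commuting subset of
  \<open>S\<close>, and Zorn's lemma enlarges it to a maximal one containing
  \<open>A\<close>.\<close>

lemma Union_MASS: "\<Union> {N. MASS S N} = S"
proof
  show "\<Union> {N. MASS S N} \<subseteq> S" by (auto simp: MASS_def)
  show "S \<subseteq> \<Union> {N. MASS S N}"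
  proof
    fix A assume A: "A \<in> S"
    define P where "P = {N. N \<subseteq> S \<and> commuting N \<and> A \<in> N}"
    have "\<exists>M\<in>P. \<forall>X\<in>P. M \<subseteq> X \<longrightarrow> X = M"
    proof (rule subset_Zorn_nonempty)
      show "P \<noteq> {}" using A by (auto simp: P_def commuting_def intro!: exI[of _ "{A}"])
      fix C assume C: "C \<noteq> {}" "subset.chain P C"
      have CP: "C \<subseteq> P" using C(2) by (simp add: subset_chain_def)
      \<comment> \<open>Two elements of the union of a chain already lie together in the larger of
        two members, which is commuting.\<close>
      have "X \<circ> Z = Z \<circ> X" if XZ: "X \<in> \<Union>C" "Z \<in> \<Union>C" for X Z
      proof -
        obtain F G where "F \<in> C" "X \<in> F" "G \<in> C" "Z \<in> G" using XZ by blast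
        moreover from this have "F \<subseteq> G \<or> G \<subseteq> F" using C(2) by (auto simp: subset_chain_def)
        ultimately obtain H where "H \<in> C" "X \<in> H" "Z \<in> H" by blast
        then show ?thesis using CP by (auto simp: P_def commuting_def)
      qed
      then show "\<Union>C \<in> P" using C(1) CP by (auto simp: P_def commuting_def)
    qed
    then obtain M where M: "M \<in> P" "\<And>X. X \<in> P \<Longrightarrow> M \<subseteq> X \<Longrightarrow> X = M" by blast
    \<comment> \<open>A commuting superset of \<open>M\<close> within \<open>S\<close> still
      contains \<open>A\<close>, hence lies in \<open>P\<close>; so maximality in \<open>P\<close>
      is maximality among all commuting subsets.\<close>
    then have "MASS S M" by (auto simp: MASS_def P_def)
    then show "A \<in> \<Union> {N. MASS S N}" using M(1) by (auto simp: P_def)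
  qed
qed

lemma commuting_image_iff:
  assumes "inj c" "\<And>A B. c (A \<circ> B) = c A \<circ> c B"
  shows "commuting (c ` N) \<longleftrightarrow> commuting N"
  by (simp add: commuting_def assms(2)[symmetric] inj_eq[OF assms(1)])

lemma MASS_image_iff:
  assumes "inj c" "\<And>A B. c (A \<circ> B) = c A \<circ> c B"
  shows "MASS (c ` S) (c ` N) \<longleftrightarrow> MASS S N"
proof -
  \<comment> \<open>Each subset of the image of \<open>S\<close> is the image of a subset of
    \<open>S\<close>; this pulls the quantifier over competing families in \<open>MASS\<close> back
    along \<open>c\<close>.\<close>
  have ex: "(\<forall>L. L \<subseteq> c ` S \<and> Q L \<longrightarrow> R L) \<longleftrightarrow> (\<forall>L. L \<subseteq> S \<and> Q (c ` L) \<longrightarrow> R (c ` L))" for Q R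
    by (auto simp: subset_image_iff)
  show ?thesis
    by (simp add: MASS_def ex commuting_image_iff[OF assms] inj_image_subset_iff[OF assms(1)]
        inj_image_eq_iff[OF assms(1)])
qed

lemma bij_betw_MASS_image:
  assumes "inj c" "\<And>A B. c (A \<circ> B) = c A \<circ> c B"
  shows "bij_betw ((`) c) {N. MASS S N} {N. MASS (c ` S) N}"
proof (rule bij_betw_imageI)
  show "inj_on ((`) c) {N. MASS S N}" by (auto simp: inj_on_def inj_image_eq_iff[OF assms(1)])
  \<comment> \<open>For surjectivity: \<open>K\<close> lies in the image of \<open>S\<close>, so it
    has the form to which \<open>MASS_image_iff\<close> applies.\<close>
  have "\<exists>N. K = c ` N" if "MASS (c ` S) K" for K
    using that by (auto simp: MASS_def subset_image_iff)
  then show "(`) c ` {N. MASS S N} = {N. MASS (c ` S) N}"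
    using MASS_image_iff[OF assms] by blast
qed

context
  fixes V :: "'a::fin_dim_hilbert \<Rightarrow> 'a"
  assumes V: "unitary V"
begin

lemma unitary_adj_right: "V (adj V x) = x"
  using V by (simp add: unitary_def fun_eq_iff)

lemma inj_unitary_conj: "inj (\<lambda>A. adj V \<circ> A \<circ> V)"
proof (rule inj_on_inverseI)
  \<comment> \<open>Conjugation by the adjoint serves as the left inverse.\<close>
  show "V \<circ> (adj V \<circ> A \<circ> V) \<circ> adj V = A" for A
    by (simp add: fun_eq_iff unitary_adj_right)
qed

text \<open>The inner factor \<open>V \<circ> adj V\<close> cancels. With injectivity, this makes
  conjugation an instance of the map \<open>c\<close> above.\<close>

lemma unitary_conj_comp: "adj V \<circ> (A \<circ> B) \<circ> V = (adj V \<circ> A \<circ> V) \<circ> (adj V \<circ> B \<circ> V)"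
  by (simp add: fun_eq_iff unitary_adj_right)

lemma coll_unitarily_equiv_via_iff:
  "coll_unitarily_equiv_via V F G \<longleftrightarrow> G = (\<lambda>A. adj V \<circ> A \<circ> V) ` F"
  using V by (simp add: coll_unitarily_equiv_via_def Setcompr_eq_image)

end

theorem theorem4p2p4:
  fixes Y :: "'y set" and W :: "'y \<Rightarrow> 'a::fin_dim_hilbert \<Rightarrow> 'a"
    and Y' :: "'z set" and W' :: "'z \<Rightarrow> 'a \<Rightarrow> 'a"
    and \<Lambda> :: "'l set" and M :: "'l \<Rightarrow> ('a \<Rightarrow> 'a) set"
    and \<Lambda>' :: "'m set" and M' :: "'m \<Rightarrow> ('a \<Rightarrow> 'a) set"
    and V :: "'a \<Rightarrow> 'a"
  assumes "hdim TYPE('a) \<ge> 2"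
    and "unitary_system Y W"
    and "unitary_system Y' W'"
    and "bij_betw M \<Lambda> {N. MASS (W ` Y) N}"
    and "bij_betw M' \<Lambda>' {N. MASS (W' ` Y') N}"
    and "unitary V"
  shows "coll_unitarily_equiv_via V (W ` Y) (W' ` Y') \<longleftrightarrow>
    (\<exists>\<phi>. bij_betw \<phi> \<Lambda> \<Lambda>' \<and>
      (\<forall>\<alpha>\<in>\<Lambda>. coll_unitarily_equiv_via V (M \<alpha>) (M' (\<phi> \<alpha>))))"
proof -
  let ?c = "\<lambda>A. adj V \<circ> A \<circ> V"
  note equiv = coll_unitarily_equiv_via_iff[OF assms(6)]
  note M = assms(4) and M' = assms(5)
  have cover: "(\<Union>\<alpha>\<in>\<Lambda>. M \<alpha>) = W ` Y" "(\<Union>\<beta>\<in>\<Lambda>'. M' \<beta>) = W' ` Y'"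
    using Union_MASS bij_betw_imp_surj_on[OF M] bij_betw_imp_surj_on[OF M'] by metis+
  show ?thesis unfolding equiv
  proof
    assume eq: "W' ` Y' = ?c ` W ` Y"
    \<comment> \<open>Conjugating the enumeration \<open>M\<close> gives a second enumeration of the
      MASSs of the primed system, now indexed by \<open>\<Lambda>\<close>.\<close>
    have MM: "bij_betw (\<lambda>\<alpha>. ?c ` M \<alpha>) \<Lambda> {N. MASS (W' ` Y') N}"
      using bij_betw_trans[OF M bij_betw_MASS_image[OF inj_unitary_conj unitary_conj_comp]]
        assms(6) by (simp add: eq comp_def)
    \<comment> \<open>The index \<open>\<alpha>\<close> goes to the index at which \<open>M'\<close>
      lists the conjugate of \<open>M \<alpha>\<close>.\<close>
    let ?\<phi> = "inv_into \<Lambda>' M' \<circ> (\<lambda>\<alpha>. ?c ` M \<alpha>)"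
    have "bij_betw ?\<phi> \<Lambda> \<Lambda>'" by (rule bij_betw_trans[OF MM bij_betw_inv_into[OF M']])
    moreover have "M' (?\<phi> \<alpha>) = ?c ` M \<alpha>" if "\<alpha> \<in> \<Lambda>" for \<alpha>
      using bij_betw_inv_into_right[OF M' bij_betwE[OF MM, rule_format, OF that]] by simp
    ultimately show "\<exists>\<phi>. bij_betw \<phi> \<Lambda> \<Lambda>' \<and> (\<forall>\<alpha>\<in>\<Lambda>. M' (\<phi> \<alpha>) = ?c ` M \<alpha>)" by blast
  next
    assume "\<exists>\<phi>. bij_betw \<phi> \<Lambda> \<Lambda>' \<and> (\<forall>\<alpha>\<in>\<Lambda>. M' (\<phi> \<alpha>) = ?c ` M \<alpha>)"
    then obtain \<phi> where \<phi>: "\<phi> ` \<Lambda> = \<Lambda>'" "\<And>\<alpha>. \<alpha> \<in> \<Lambda> \<Longrightarrow> M' (\<phi> \<alpha>) = ?c ` M \<alpha>"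
      by (auto simp: bij_betw_def)
    \<comment> \<open>Surjectivity of \<open>\<phi>\<close> reindexes the cover of the primed system
      by \<open>\<Lambda>\<close>; conjugation then comes out of the union, since images commute
      with unions.\<close>
    have "W' ` Y' = (\<Union>\<alpha>\<in>\<Lambda>. M' (\<phi> \<alpha>))" by (simp add: cover(2)[symmetric] \<phi>(1)[symmetric])
    also have "\<dots> = ?c ` (\<Union>\<alpha>\<in>\<Lambda>. M \<alpha>)" by (simp only: image_UN \<phi>(2) cong: SUP_cong)
    finally show "W' ` Y' = ?c ` W ` Y" by (simp only: cover(1))
  qed
qed

end
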